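(* Let $F:\mathbb{R}^{2n+1}\to\mathbb{H}^n$ define standard coordinates and let $\rho$ be a homogeneous distance of $\mathbb{H}^n$ such that the function $\rho(0,F(\cdot)):\mathbb{R}^{2n+1}\to\mathbb{R}$ depends only on $(|\tilde x|,x_{2n+1})$, where $\tilde x=(x_1,\dots,x_{2n})$, $|\cdot|$ is the Euclidean norm and $0$ is the unit element of $\mathbb{H}^n$. Then $\theta_p^\rho(\tau)=\theta_p^\rho(\tilde\tau)$ whenever $\tau,\tilde\tau$ are (nonzero) vertical simple $p$-vectors.
   Context: Heisenberg group: $\mathbb{H}^n$ is the simply connected Lie group of dimension $2n+1$ whose Lie algebra $\mathfrak h^n$ (identified with left invariant vector fields) has a basis $(X_1,\dots,X_{2n},Z)$ whose only nontrivial brackets are $[X_k,X_{k+n}]=2Z$, $k=1,\dots,n$. Standard coordinates are given by the diffeomorphism $F:\mathbb{R}^{2n+1}\to\mathbb{H}^n$, $F(y)=\exp\big(y_{2n+1}Z+\sum_{j=1}^{2n}y_jX_j\big)$; in them the group law is $x\cdot y=\big(x_1+y_1,\dots,x_{2n}+y_{2n},\,x_{2n+1}+y_{2n+1}+\sum_{k=1}^n(x_ky_{k+n}-x_{k+n}y_k)\big)$. Dilations are $\delta_r(x)=(rx_1,\dots,rx_{2n},r^2x_{2n+1})$, $r>0$. A homogeneous distance $\rho$ on $\mathbb{H}^n$ is a distance that is continuous for the topology of $\mathbb{H}^n$, left invariant and satisfies $\rho(\delta_ry,\delta_rz)=r\rho(y,z)$ for all $r>0$. $B_1$ is the open $\rho$-ball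 of radius $1$ centered at the unit element. Vertical $p$-vectors are the linear combinations of $X_{j_1}\wedge\dots\wedge X_{j_{p-1}}\wedge Z$, $1\le j_s\le 2n$, in $\Lambda_p(\mathfrak h^n)$. Metric factor: for a nonzero vertical simple $p$-vector $\tau$ let $\mathcal L(\tau)=\{v\in\mathfrak h^n: v\wedge\tau=0\}$; then $\theta_p^\rho(\tau)=\mathcal H^p_{|\cdot|}\big(F^{-1}(\exp\mathcal L(\tau)\cap B_1)\big)$, where $\mathcal H^p_{|\cdot|}$ is the Euclidean $p$-dimensional Hausdorff measure on $\mathbb{R}^{2n+1}$. *)

theory Defs
  imports "HOL-Analysis.Analysis"
begin

section \<open>Indices $1,\dots,2n+1$\<close>

text \<open>
  With \<open>n = CARD('n)\<close> and \<open>'n\<close> read as $\{1,\dots,n\}$: \<open>Lo k\<close> stands for the index $k$,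
  \<open>Hi k\<close> for $k+n$ and \<open>Vt\<close> for $2n+1$. Hence \<open>real^'n hidx\<close> is $\mathbb{R}^{2n+1}$ with its
  Euclidean norm. The linear order is the usual one of $1,\dots,2n+1$.
\<close>

datatype 'n hidx = Lo 'n | Hi 'n | Vt

lemma UNIV_hidx: "(UNIV :: 'n hidx set) = insert Vt (range Lo \<union> range Hi)"
  by (auto simp: image_iff) (metis hidx.exhaust)

instance hidx :: (finite) finite
  by standard (simp add: UNIV_hidx)

instantiation hidx :: (linorder) linorder
begin

definition less_eq_hidx :: "'a hidx \<Rightarrow> 'a hidx \<Rightarrow> bool" where
  "less_eq_hidx i j = (case i of
      Lo k \<Rightarrow> (case j of Lo l \<Rightarrow> k \<le> l | _ \<Rightarrow> True)
    | Hi k \<Rightarrow> (case j of Lo _ \<Rightarrow> False | Hi l \<Rightarrow> k \<le> l | Vt \<Rightarrow> True)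
    | Vt \<Rightarrow> j = Vt)"

definition less_hidx :: "'a hidx \<Rightarrow> 'a hidx \<Rightarrow> bool" where
  "less_hidx i j \<longleftrightarrow> i \<le> j \<and> \<not> j \<le> i"

instance
  by standard (auto simp: less_eq_hidx_def less_hidx_def split: hidx.splits)

end

section \<open>The Heisenberg Lie algebra\<close>

text \<open>
  $\mathfrak{h}^n$ is the vector space \<open>real^'n hidx\<close>; its distinguished basis
  $(X_1,\dots,X_{2n},Z)$ consists of the standard unit vectors.
\<close>

type_synonym 'n heis_alg = "real^'n hidx"

definition hX :: "'n::finite hidx \<Rightarrow> 'n heis_alg" where
  "hX j = axis j 1"

definition hZ :: "'n::finite heis_alg" where
  "hZ = axis Vt 1"

definition hbracket :: "'n::finite heis_alg \<Rightarrow> 'n heis_alg \<Rightarrow> 'n heis_alg" where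
  "hbracket u v = (\<Sum>k\<in>UNIV. u $ Lo k * v $ Hi k - u $ Hi k * v $ Lo k) *\<^sub>R (2 *\<^sub>R hZ)"

lemma hbracket_Vt: "hbracket u v $ Vt = 2 * (\<Sum>k\<in>UNIV. u $ Lo k * v $ Hi k - u $ Hi k * v $ Lo k)"
  and hbracket_Lo [simp]: "hbracket u v $ Lo k = 0"
  and hbracket_Hi [simp]: "hbracket u v $ Hi k = 0"
  by (simp_all add: hbracket_def hZ_def axis_def)

lemma hbracket_basis:
  "hbracket (hX (Lo k)) (hX (Hi k)) = 2 *\<^sub>R hZ"
  "k \<noteq> l \<Longrightarrow> hbracket (hX (Lo k)) (hX (Hi l)) = 0"
  "hbracket (hX (Lo k)) (hX (Lo l)) = 0"
  "hbracket (hX (Hi k)) (hX (Hi l)) = 0"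
  "hbracket u hZ = 0"
  by (simp_all add: hbracket_def hX_def hZ_def axis_def mult_delta_left mult_delta_right
      cong: if_cong)

lemma hbracket_antisym: "hbracket v u = - hbracket u v"
  by (simp add: hbracket_def sum_subtractf mult.commute algebra_simps)

lemma bilinear_hbracket: "bilinear hbracket"
  unfolding bilinear_def
  by (auto intro!: linearI simp: vec_eq_iff hbracket_def sum_subtractf sum.distrib sum_distrib_left
      algebra_simps)

section \<open>The Heisenberg group\<close>

text \<open>
  $\mathbb{H}^n$ is the simply connected group with Lie algebra $\mathfrak{h}^n$: the exponential map
  \<open>hexp\<close> is a bijection onto it and the product is given by the Baker-Campbell-Hausdorff formula,
  which stops after the first bracket because the algebra has step two. The topology is the one
  making \<open>hexp\<close> a homeomorphism. The (noncommutative) group operation is written \<open>+\<close> and the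
  unit element \<open>0\<close>, as required by the class \<^class>\<open>group_add\<close>.
\<close>

typedef 'n heis = "UNIV :: (real^'n::finite hidx) set"
  morphisms hlog hexp ..

setup_lifting type_definition_heis

lemma hlog_hexp [simp]: "hlog (hexp v) = v"
  by (simp add: hexp_inverse)

instantiation heis :: (finite) group_add
begin

lift_definition zero_heis :: "'a heis" is 0 .
lift_definition plus_heis :: "'a heis \<Rightarrow> 'a heis \<Rightarrow> 'a heis"
  is "\<lambda>u v. u + v + (1/2) *\<^sub>R hbracket u v" .
lift_definition uminus_heis :: "'a heis \<Rightarrow> 'a heis" is "\<lambda>u. - u" .
lift_definition minus_heis :: "'a heis \<Rightarrow> 'a heis \<Rightarrow> 'a heis"
  is "\<lambda>u v. u - v - (1/2) *\<^sub>R hbracket u v" .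

instance
proof
  fix a b c :: "'a heis"
  have nil: "hbracket (hbracket u v) w = 0" "hbracket u (hbracket v w) = 0"
    for u v w :: "'a heis_alg"
    by (simp_all add: hbracket_def hZ_def axis_def)
  note bil = bilinear_ladd[OF bilinear_hbracket] bilinear_radd[OF bilinear_hbracket]
    bilinear_lmul[OF bilinear_hbracket] bilinear_rmul[OF bilinear_hbracket]
    bilinear_lneg[OF bilinear_hbracket] bilinear_rneg[OF bilinear_hbracket]
    bilinear_lzero[OF bilinear_hbracket] bilinear_rzero[OF bilinear_hbracket]
  have self: "hbracket u u = 0" for u :: "'a heis_alg"
    by (simp add: hbracket_def mult.commute)
  show "a + b + c = a + (b + c)"
    by transfer (simp add: bil nil algebra_simps)
  show "0 + a = a" "a + 0 = a"
    by (transfer; simp add: bil)+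
  show "- a + a = 0"
    by transfer (simp add: bil self)
  show "a + - b = a - b"
    by transfer (simp add: bil)
qed

end

instantiation heis :: (finite) topological_space
begin

definition open_heis :: "'a heis set \<Rightarrow> bool" where
  "open_heis U \<longleftrightarrow> open (hexp -` U)"

instance
  by standard (auto simp: open_heis_def vimage_Union)

end

lemma hexp_one_parameter: "hexp (s *\<^sub>R v) + hexp (t *\<^sub>R v) = hexp ((s + t) *\<^sub>R v)"
  by (simp add: plus_heis_def hbracket_def algebra_simps)

definition std_coords :: "real^'n hidx \<Rightarrow> 'n::finite heis" where
  "std_coords y = hexp (y $ Vt *\<^sub>R hZ + (\<Sum>j\<in>-{Vt}. y $ j *\<^sub>R hX j))"

lemma std_coords_eq_hexp: "std_coords y = hexp y"
proof -
  have "y $ Vt *\<^sub>R hZ + (\<Sum>j\<in>-{Vt}. y $ j *\<^sub>R hX j) = (\<Sum>j\<in>UNIV. y $ j *\<^sub>R axis j 1)"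
    by (simp add: hZ_def hX_def sum.remove[of UNIV Vt] Compl_eq_Diff_UNIV)
  also have "\<dots> = y"
    using basis_expansion[of y] by (simp add: scalar_mult_eq_scaleR)
  finally show ?thesis
    by (simp add: std_coords_def)
qed

lemma std_coords_add:
  "std_coords x + std_coords y =
     std_coords (\<chi> j. if j = Vt
       then x $ Vt + y $ Vt + (\<Sum>k\<in>UNIV. x $ Lo k * y $ Hi k - x $ Hi k * y $ Lo k)
       else x $ j + y $ j)"
  unfolding std_coords_eq_hexp plus_heis_def map_fun_def o_def id_def hlog_hexp
  by (intro arg_cong[where f = hexp], unfold vec_eq_iff, intro allI, case_tac i)
    (simp_all add: hbracket_Vt)

definition heis_dilation :: "real \<Rightarrow> 'n::finite heis \<Rightarrow> 'n heis" where
  "heis_dilation r x =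
     (let y = inv std_coords x
      in std_coords (\<chi> j. if j = Vt then r\<^sup>2 * y $ j else r * y $ j))"

definition homogeneous_distance :: "('n::finite heis \<Rightarrow> 'n heis \<Rightarrow> real) \<Rightarrow> bool" where
  "homogeneous_distance \<rho> \<longleftrightarrow>
     Metric_space UNIV \<rho> \<and>
     continuous_on UNIV (\<lambda>(x, y). \<rho> x y) \<and>
     (\<forall>x y z. \<rho> (x + y) (x + z) = \<rho> y z) \<and>
     (\<forall>r>0. \<forall>y z. \<rho> (heis_dilation r y) (heis_dilation r z) = r * \<rho> y z)"

text \<open>$|\tilde x|$, the Euclidean norm of the first $2n$ coordinates.\<close>

definition horizontal_norm :: "real^'n::finite hidx \<Rightarrow> real" where
  "horizontal_norm x = L2_set (\<lambda>j. x $ j) (-{Vt})"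

section \<open>The exterior algebra of $\mathbb{R}^I$\<close>

text \<open>
  For a finite linearly ordered index type, \<open>real^('i set)\<close> is the exterior algebra of
  \<open>real^'i\<close>: its unit vector at $S = \{s_1 < \dots < s_p\}$ is
  $e_{s_1} \wedge \dots \wedge e_{s_p}$. The exponent in \<open>wedge\<close> counts the transpositions
  that sort the concatenation of $S$ and $U \setminus S$.
\<close>

definition wedge ::
    "real^('i::{finite,linorder} set) \<Rightarrow> real^('i set) \<Rightarrow> real^('i set)" (infixr \<open>\<and>\<^sub>e\<close> 70) where
  "a \<and>\<^sub>e b = (\<chi> U. \<Sum>S\<in>Pow U.
     (-1) ^ card {(s, t). s \<in> S \<and> t \<in> U - S \<and> t < s} * a $ S * b $ (U - S))"

definition mvec :: "real^'i::finite \<Rightarrow> real^('i set)" where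
  "mvec v = (\<Sum>i\<in>UNIV. v $ i *\<^sub>R axis {i} 1)"

fun wedge_list :: "(real^'i::{finite,linorder}) list \<Rightarrow> real^('i set)" where
  "wedge_list [] = axis {} 1"
| "wedge_list (v # vs) = mvec v \<and>\<^sub>e wedge_list vs"

lemma wedge_axis:
  "axis S 1 \<and>\<^sub>e axis T 1 =
     (if S \<inter> T = {} then (-1) ^ card {(s, t). s \<in> S \<and> t \<in> T \<and> t < s} *\<^sub>R axis (S \<union> T) 1 else 0)"
proof (subst vec_eq_iff, intro allI)
  fix U
  have "(axis S 1 \<and>\<^sub>e axis T 1) $ U = (\<Sum>S'\<in>Pow U. if S' = S then
      (-1) ^ card {(s, t). s \<in> S \<and> t \<in> U - S \<and> t < s} * (if U - S = T then 1 else 0) else 0)"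
    unfolding wedge_def vec_lambda_beta by (rule sum.cong) (auto simp: axis_def)
  also have "\<dots> = (if S \<subseteq> U \<and> U - S = T
      then (-1) ^ card {(s, t). s \<in> S \<and> t \<in> T \<and> t < s} else 0)"
    by (subst sum.delta) auto
  also have "\<dots> = (if S \<inter> T = {} then (-1) ^ card {(s, t). s \<in> S \<and> t \<in> T \<and> t < s} *\<^sub>R axis (S \<union> T) 1 else 0) $ U"
  proof -
    have "S \<subseteq> U \<and> U - S = T \<longleftrightarrow> S \<inter> T = {} \<and> U = S \<union> T"
      by blast
    then show ?thesis
      by (simp add: axis_def)
  qed
  finally show "(axis S 1 \<and>\<^sub>e axis T 1) $ U = (if S \<inter> T = {}
      then (-1) ^ card {(s, t). s \<in> S \<and> t \<in> T \<and> t < s} *\<^sub>R axis (S \<union> T) 1 else 0) $ U" .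
qed

lemma mvec_axis: "mvec (axis i 1) = axis {i} 1"
proof -
  have "(if k = i then 1 else 0) *\<^sub>R axis {k} 1 = (if k = i then axis {i} 1 else 0 :: real^('a set))" for k
    by simp
  then show ?thesis
    by (simp add: mvec_def axis_def[of i])
qed

lemma wedge_list_axis:
  "sorted_wrt (<) is \<Longrightarrow> wedge_list (map (\<lambda>i. axis i 1) is) = axis (set is) 1"
proof (induction "is")
  case (Cons i "is")
  then have *: "{(s, t). s \<in> {i} \<and> t \<in> set is \<and> t < s} = {}" "{i} \<inter> set is = {}"
    by auto
  have "wedge_list (map (\<lambda>i. axis i 1) (i # is)) = axis {i} 1 \<and>\<^sub>e axis (set is) 1"
    using Cons by (simp add: mvec_axis)
  also have "\<dots> = axis ({i} \<union> set is) 1"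
    unfolding wedge_axis * by simp
  finally show ?case
    by simp
qed simp

definition simple_pvector :: "nat \<Rightarrow> real^('i::{finite,linorder} set) \<Rightarrow> bool" where
  "simple_pvector p \<tau> \<longleftrightarrow> (\<exists>vs. length vs = p \<and> \<tau> = wedge_list vs)"

definition vertical_pvector :: "nat \<Rightarrow> real^('n::{finite,linorder} hidx set) \<Rightarrow> bool" where
  "vertical_pvector p \<tau> \<longleftrightarrow>
     \<tau> \<in> span {wedge_list (map hX js @ [hZ]) | js. Vt \<notin> set js \<and> length js + 1 = p}"

definition pvector_space :: "real^('n::{finite,linorder} hidx set) \<Rightarrow> 'n heis_alg set" where
  "pvector_space \<tau> = {v. mvec v \<and>\<^sub>e \<tau> = 0}"

section \<open>Hausdorff measure and the metric factor\<close>

text \<open>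
  The weight of a covering set is the volume of the \<open>p\<close>-dimensional Euclidean ball of the same
  diameter. Empty sets have weight \<open>0\<close> also for \<open>p = 0\<close>; boundedness is required because
  \<^const>\<open>diameter\<close> is unspecified on unbounded sets.
\<close>

definition hausdorff_pre :: "nat \<Rightarrow> real \<Rightarrow> 'a::metric_space set \<Rightarrow> ennreal" where
  "hausdorff_pre p \<delta> A =
     (INF U \<in> {U :: nat \<Rightarrow> 'a set. A \<subseteq> (\<Union>i. U i) \<and> (\<forall>i. bounded (U i) \<and> diameter (U i) \<le> \<delta>)}.
        \<Sum>i. if U i = {} then 0 else ennreal (unit_ball_vol (real p) * (diameter (U i) / 2) ^ p))"

definition hausdorff_measure :: "nat \<Rightarrow> 'a::metric_space set \<Rightarrow> ennreal" where
  "hausdorff_measure p A = (SUP \<delta>\<in>{0<..}. hausdorff_pre p \<delta> A)"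

definition metric_factor ::
    "('n::{finite,linorder} heis \<Rightarrow> 'n heis \<Rightarrow> real) \<Rightarrow> nat \<Rightarrow> real^('n hidx set) \<Rightarrow> ennreal" where
  "metric_factor \<rho> p \<tau> =
     hausdorff_measure p
       (std_coords -` (hexp ` pvector_space \<tau> \<inter> Metric_space.mball UNIV \<rho> 0 1))"

end

theory Submission
  imports Defs
begin

text \<open>
  The metric factor of $\tau$ only sees the linear space $\mathcal{L}(\tau)$. If
  $\tau = v_1 \wedge \dots \wedge v_p \neq 0$, this space is the span of $v_1, \dots, v_p$ and has
  dimension $p$ (\<open>pvector_space_wedge_list\<close>, \<open>dim_pvector_space\<close>); if $\tau$ is vertical, the space
  contains $Z$ (\<open>hZ_mem_pvector_space\<close>). Any two subspaces of the same dimension that both contain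
  $Z$ are exchanged by an orthogonal map that fixes $Z$
  (\<open>orthogonal_transformation_between_subspaces\<close>). Such a map preserves the coordinate along $Z$ and
  hence also the length of the complementary horizontal part. Since the distance to the unit element
  depends only on these two quantities, the map preserves the unit ball. Therefore it carries $\mathcal{L}(\tau) \cap B_1$ onto
  $\mathcal{L}(\tilde\tau) \cap B_1$, and Hausdorff measure is invariant under isometries
  (\<open>hausdorff_measure_isometry_image\<close>).

  The description of $\mathcal{L}(\tau)$ rests on two identities in the exterior algebra: vectors
  anticommute, so that a vector in the span of the factors annihilates $\tau$; and the contraction
  $\iota_\phi$ with a vector $\phi$ satisfies
  $\iota_\phi(v \wedge a) = (\phi \cdot v)\, a - v \wedge \iota_\phi a$, so that no other vector
  does.
\<close>

section \<open>Multiplication by a vector in the exterior algebra\<close>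

text \<open>
  The sign that arises when $e_i$ is moved past the smaller elements of $e_U$ to its sorted place.
\<close>

definition position_sign :: "'i::{finite,linorder} set \<Rightarrow> 'i \<Rightarrow> real" where
  "position_sign U i = (-1) ^ card {t \<in> U. t < i}"

lemma position_sign_square [simp]: "position_sign U i * position_sign U i = 1"
  by (simp add: position_sign_def flip: power_add)

lemma position_sign_insert:
  "j \<notin> U \<Longrightarrow> position_sign (insert j U) i = (if j < i then - position_sign U i else position_sign U i)"
proof (cases "j < i")
  case True
  assume "j \<notin> U"
  moreover have "{t \<in> insert j U. t < i} = insert j {t \<in> U. t < i}"
    using True by auto
  ultimately show ?thesis
    using True by (simp add: position_sign_def)
next
  case False
  then have "{t \<in> insert j U. t < i} = {t \<in> U. t < i}"
    by auto
  then show ?thesis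
    using False by (simp add: position_sign_def)
qed

lemma position_sign_remove:
  assumes "j \<in> U"
  shows "position_sign (U - {j}) i = (if j < i then - position_sign U i else position_sign U i)"
  using position_sign_insert[of j "U - {j}" i] assms by (auto simp: insert_absorb)

lemma mvec_nth: "mvec v $ {i} = v $ i"
  by (simp add: mvec_def axis_def mult_delta_right if_distrib cong: if_cong)

lemma mvec_nth_eq_0:
  assumes "\<And>i. S \<noteq> {i}"
  shows "mvec v $ S = 0"
  using assms by (simp add: mvec_def axis_def)

lemma mvec_wedge_nth:
  "(mvec v \<and>\<^sub>e a) $ U = (\<Sum>i\<in>U. position_sign U i * v $ i * a $ (U - {i}))"
proof -
  let ?f = "\<lambda>S. (-1) ^ card {(s, t). s \<in> S \<and> t \<in> U - S \<and> t < s} * mvec v $ S * a $ (U - S)"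
  have "{(s, t). s \<in> {i} \<and> t \<in> U - {i} \<and> t < s} = Pair i ` {t \<in> U. t < i}" for i
    by auto
  then have sgn: "(-1) ^ card {(s, t). s \<in> {i} \<and> t \<in> U - {i} \<and> t < s} = position_sign U i" for i
    by (simp add: position_sign_def card_image inj_on_def)
  have "(mvec v \<and>\<^sub>e a) $ U = sum ?f (Pow U)"
    by (simp add: wedge_def)
  also have "\<dots> = sum ?f ((\<lambda>i. {i}) ` U)"
    by (rule sum.mono_neutral_right) (auto simp: image_iff intro!: mvec_nth_eq_0)
  also have "\<dots> = (\<Sum>i\<in>U. ?f {i})"
    by (simp add: sum.reindex inj_on_def)
  finally show ?thesis
    by (simp only: sgn mvec_nth)
qed

lemma linear_wedge_right: "linear (\<lambda>a. mvec v \<and>\<^sub>e a)"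
  by (rule linearI)
    (simp_all add: vec_eq_iff mvec_wedge_nth sum.distrib sum_distrib_left algebra_simps)

lemma linear_mvec_wedge_left: "linear (\<lambda>v. mvec v \<and>\<^sub>e a)"
  by (rule linearI)
    (simp_all add: vec_eq_iff mvec_wedge_nth sum.distrib sum_distrib_left algebra_simps)

lemma subspace_pvector_space: "subspace (pvector_space \<tau>)"
  unfolding pvector_space_def by (rule linear_subspace_kernel[OF linear_mvec_wedge_left])

text \<open>
  Removing $i$ and $j$ from $U$ in either order leaves the same set, but the removal of the smaller
  index flips the sign of the larger one; so the two orders differ by exactly one sign.
\<close>

lemma mvec_wedge_anticommute:
  fixes v w :: "real^'i::{finite,linorder}"
  shows "mvec v \<and>\<^sub>e (mvec w \<and>\<^sub>e a) = - (mvec w \<and>\<^sub>e (mvec v \<and>\<^sub>e a))"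
proof (subst vec_eq_iff, intro allI)
  fix U
  define g where "g v w i j = (if i = j then 0 else
      position_sign U i * position_sign (U - {i}) j * (v $ i * w $ j * a $ (U - {i} - {j})))"
    for v w :: "real^'i::{finite,linorder}" and i j
  have expand: "(mvec v \<and>\<^sub>e (mvec w \<and>\<^sub>e a)) $ U = (\<Sum>i\<in>U. \<Sum>j\<in>U. g v w i j)" for v w
  proof -
    have "position_sign U i * v $ i * (\<Sum>j\<in>U - {i}. position_sign (U - {i}) j * w $ j * a $ (U - {i} - {j}))
        = (\<Sum>j\<in>U. g v w i j)" if "i \<in> U" for i
    proof -
      have "(\<Sum>j\<in>U. g v w i j) = (\<Sum>j\<in>U - {i}. g v w i j)"
        by (rule sum.mono_neutral_right) (auto simp: g_def)
      also have "\<dots> = (\<Sum>j\<in>U - {i}. position_sign U i * v $ i *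
          (position_sign (U - {i}) j * w $ j * a $ (U - {i} - {j})))"
        by (rule sum.cong) (auto simp: g_def)
      finally show ?thesis
        by (simp add: sum_distrib_left)
    qed
    then show ?thesis
      by (simp add: mvec_wedge_nth)
  qed
  have swap: "g v w i j = - g w v j i" if "i \<in> U" "j \<in> U" for i j
  proof (cases "i = j")
    case False
    have "position_sign U i * position_sign (U - {i}) j = - (position_sign U j * position_sign (U - {j}) i)"
      using that False by (cases "i < j") (auto simp: position_sign_remove)
    moreover have "U - {j} - {i} = U - {i} - {j}"
      by blast
    ultimately show ?thesis
      using False False[symmetric]
      by (simp only: g_def if_False mult_minus_left mult.commute[of "v $ i"])
  qed (simp add: g_def)
  have "(\<Sum>i\<in>U. \<Sum>j\<in>U. g v w i j) = (\<Sum>i\<in>U. \<Sum>j\<in>U. - g w v j i)"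
    by (intro sum.cong refl swap)
  also have "\<dots> = (\<Sum>j\<in>U. \<Sum>i\<in>U. - g w v j i)"
    by (rule sum.swap)
  finally show "(mvec v \<and>\<^sub>e (mvec w \<and>\<^sub>e a)) $ U = (- (mvec w \<and>\<^sub>e (mvec v \<and>\<^sub>e a))) $ U"
    by (simp add: expand sum_negf)
qed

lemma mvec_wedge_self: "mvec v \<and>\<^sub>e (mvec v \<and>\<^sub>e a) = 0"
proof -
  have "x = - x \<Longrightarrow> x = 0" for x :: "real^('a set)"
    by (simp add: vec_eq_iff)
  then show ?thesis
    using mvec_wedge_anticommute by blast
qed

lemma mvec_wedge_repeated_factor: "v \<in> set vs \<Longrightarrow> mvec v \<and>\<^sub>e wedge_list vs = 0"
proof (induction vs)
  case (Cons w ws)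
  show ?case
  proof (cases "v = w")
    case True
    then show ?thesis
      by (simp add: mvec_wedge_self)
  next
    case False
    then have "mvec v \<and>\<^sub>e wedge_list ws = 0"
      using Cons by simp
    then show ?thesis
      using mvec_wedge_anticommute[of v w "wedge_list ws"]
      by (simp add: linear_0[OF linear_wedge_right])
  qed
qed simp

section \<open>Contraction and the space of a simple vector\<close>

definition contraction :: "real^'i::{finite,linorder} \<Rightarrow> real^('i set) \<Rightarrow> real^('i set)" where
  "contraction \<phi> a = (\<chi> U. \<Sum>j\<in>-U. position_sign U j * \<phi> $ j * a $ insert j U)"

lemma contraction_0 [simp]: "contraction \<phi> 0 = 0"
  by (simp add: contraction_def vec_eq_iff)

text \<open>
  Contraction is an antiderivation. In coordinates, inserting $j$ and removing $i \neq j$ in either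
  order produces opposite signs, because exactly one of $i < j$ and $j < i$ holds; so the mixed terms
  cancel, and the terms with $i = j$ add up to the inner product.
\<close>

lemma contraction_mvec_wedge:
  "contraction \<phi> (mvec v \<and>\<^sub>e a) = (\<phi> \<bullet> v) *\<^sub>R a - mvec v \<and>\<^sub>e contraction \<phi> a"
proof (subst vec_eq_iff, intro allI)
  fix U
  define t where "t j i = position_sign U j * position_sign (insert j U) i *
      (\<phi> $ j * v $ i * a $ (insert j U - {i}))" for j i
  have "contraction \<phi> (mvec v \<and>\<^sub>e a) $ U = (\<Sum>j\<in>-U. \<phi> $ j * v $ j * a $ U + (\<Sum>i\<in>U. t j i))"
  proof -
    have "position_sign U j * \<phi> $ j *
        (\<Sum>i\<in>insert j U. position_sign (insert j U) i * v $ i * a $ (insert j U - {i}))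
      = \<phi> $ j * v $ j * a $ U + (\<Sum>i\<in>U. t j i)" (is "?c * sum ?f (insert j U) = _") if "j \<in> -U" for j
    proof -
      have "?c * sum ?f (insert j U) = ?c * ?f j + (\<Sum>i\<in>U. ?c * ?f i)"
        using that by (simp add: sum_distrib_left distrib_left)
      moreover have "position_sign (insert j U) j = position_sign U j" "insert j U - {j} = U"
        using that by (auto simp: position_sign_insert)
      then have "?c * ?f j = position_sign U j * position_sign U j * (\<phi> $ j * v $ j * a $ U)"
        by (simp only: mult_ac)
      then have "?c * ?f j = \<phi> $ j * v $ j * a $ U"
        by simp
      moreover have "?c * ?f i = t j i" for i
        by (simp only: t_def mult_ac)
      ultimately show ?thesis
        by simp
    qed
    then show ?thesis
      by (simp add: contraction_def mvec_wedge_nth)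
  qed
  moreover have "(mvec v \<and>\<^sub>e contraction \<phi> a) $ U = (\<Sum>i\<in>U. \<phi> $ i * v $ i * a $ U - (\<Sum>j\<in>-U. t j i))"
  proof -
    have "position_sign U i * v $ i *
        (\<Sum>j\<in>-(U - {i}). position_sign (U - {i}) j * \<phi> $ j * a $ insert j (U - {i}))
      = \<phi> $ i * v $ i * a $ U - (\<Sum>j\<in>-U. t j i)" (is "?c * sum ?f _ = _") if "i \<in> U" for i
    proof -
      have compl: "-(U - {i}) = insert i (-U)"
        using that by auto
      have "?c * sum ?f (-(U - {i})) = ?c * ?f i + (\<Sum>j\<in>-U. ?c * ?f j)"
        unfolding compl using that by (simp add: sum_distrib_left distrib_left)
      moreover have "position_sign (U - {i}) i = position_sign U i" "insert i (U - {i}) = U"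
        using that by (auto simp: position_sign_remove)
      then have "?c * ?f i = position_sign U i * position_sign U i * (\<phi> $ i * v $ i * a $ U)"
        by (simp only: mult_ac)
      then have "?c * ?f i = \<phi> $ i * v $ i * a $ U"
        by simp
      moreover have "(\<Sum>j\<in>-U. ?c * ?f j) = (\<Sum>j\<in>-U. - t j i)"
      proof (rule sum.cong[OF refl])
        fix j assume j: "j \<in> -U"
        then have ins: "insert j U - {i} = insert j (U - {i})" and "i \<noteq> j"
          using that by auto
        have sgn: "position_sign U i * position_sign (U - {i}) j
            = - (position_sign U j * position_sign (insert j U) i)"
          using that j \<open>i \<noteq> j\<close> by (cases "i < j") (auto simp: position_sign_remove position_sign_insert)
        have "?c * ?f j = (position_sign U i * position_sign (U - {i}) j) *
            (\<phi> $ j * v $ i * a $ insert j (U - {i}))"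
          by (simp only: mult_ac)
        also have "\<dots> = - t j i"
          by (simp only: sgn t_def ins mult_minus_left)
        finally show "?c * ?f j = - t j i" .
      qed
      ultimately show ?thesis
        by (simp add: sum_negf)
    qed
    then show ?thesis
      by (simp add: contraction_def mvec_wedge_nth)
  qed
  moreover have "(\<Sum>j\<in>-U. \<Sum>i\<in>U. t j i) = (\<Sum>i\<in>U. \<Sum>j\<in>-U. t j i)"
    by (rule sum.swap)
  moreover have "\<phi> \<bullet> v * a $ U = (\<Sum>j\<in>-U. \<phi> $ j * v $ j * a $ U) + (\<Sum>i\<in>U. \<phi> $ i * v $ i * a $ U)"
  proof -
    have "\<phi> \<bullet> v * a $ U = (\<Sum>i\<in>UNIV. \<phi> $ i * v $ i * a $ U)"
      by (simp add: inner_vec_def sum_distrib_right)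
    also have "\<dots> = (\<Sum>i\<in>UNIV - U. \<phi> $ i * v $ i * a $ U) + (\<Sum>i\<in>U. \<phi> $ i * v $ i * a $ U)"
      by (rule sum.subset_diff) auto
    finally show ?thesis
      by (simp only: Compl_eq_Diff_UNIV)
  qed
  ultimately show "contraction \<phi> (mvec v \<and>\<^sub>e a) $ U
      = ((\<phi> \<bullet> v) *\<^sub>R a - mvec v \<and>\<^sub>e contraction \<phi> a) $ U"
    by (simp add: sum.distrib sum_subtractf)
qed

lemma contraction_wedge_list_orthogonal:
  "(\<And>w. w \<in> set ws \<Longrightarrow> \<phi> \<bullet> w = 0) \<Longrightarrow> contraction \<phi> (wedge_list ws) = 0"
proof (induction ws)
  case Nil
  show ?case
    by (simp add: contraction_def vec_eq_iff axis_def)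
next
  case (Cons w ws)
  then show ?case
    by (simp add: contraction_mvec_wedge linear_0[OF linear_wedge_right])
qed

text \<open>
  For $v$ outside the span of the factors, its component $\phi$ orthogonal to that span satisfies
  $\phi \cdot v \neq 0$ and annihilates $\tau$ under contraction; contracting $v \wedge \tau = 0$ with
  $\phi$ then gives $\tau = 0$.
\<close>

lemma pvector_space_wedge_list:
  assumes "wedge_list vs \<noteq> 0"
  shows "pvector_space (wedge_list vs) = span (set vs)"
proof
  show "span (set vs) \<subseteq> pvector_space (wedge_list vs)"
    by (rule span_minimal[OF _ subspace_pvector_space])
      (auto simp: pvector_space_def mvec_wedge_repeated_factor)
  show "pvector_space (wedge_list vs) \<subseteq> span (set vs)"
  proof
    fix v assume v: "v \<in> pvector_space (wedge_list vs)"
    obtain y \<phi> where y: "y \<in> span (set vs)" and \<phi>: "\<And>w. w \<in> span (set vs) \<Longrightarrow> orthogonal \<phi> w"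
      and decomp: "v = y + \<phi>"
      using orthogonal_subspace_decomp_exists[of "set vs" v] by blast
    have "contraction \<phi> (wedge_list vs) = 0"
      using \<phi> by (intro contraction_wedge_list_orthogonal) (simp add: orthogonal_def span_base)
    then have "(\<phi> \<bullet> v) *\<^sub>R wedge_list vs = 0"
      using v contraction_mvec_wedge[of \<phi> v "wedge_list vs"]
      by (simp add: pvector_space_def linear_0[OF linear_wedge_right])
    moreover have "\<phi> \<bullet> v = \<phi> \<bullet> \<phi>"
      using \<phi>[OF y] by (simp add: decomp inner_add_right orthogonal_def)
    ultimately have "\<phi> = 0"
      using assms by simp
    then show "v \<in> span (set vs)"
      using y decomp by simp
  qed
qed

text \<open>
  The first factor $v$ of a nonzero product does not annihilate the product of the others, so by
  \<open>pvector_space_wedge_list\<close> it lies outside their span.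
\<close>

lemma wedge_list_nonzero_independent:
  fixes vs :: "'n::{finite,linorder} heis_alg list"
  shows "wedge_list vs \<noteq> 0 \<Longrightarrow> distinct vs \<and> independent (set vs)"
proof (induction vs)
  case (Cons v vs)
  have nz: "mvec v \<and>\<^sub>e wedge_list vs \<noteq> 0"
    using Cons.prems by simp
  then have vs: "wedge_list vs \<noteq> 0"
    by (auto simp: linear_0[OF linear_wedge_right])
  have "v \<notin> span (set vs)"
    using nz pvector_space_wedge_list[OF vs] by (auto simp: pvector_space_def)
  then show ?case
    using Cons.IH[OF vs] by (auto simp: independent_insert intro: span_base)
qed (simp add: independent_empty)

lemma dim_pvector_space:
  assumes "simple_pvector p \<tau>" "\<tau> \<noteq> 0"
  shows "dim (pvector_space \<tau>) = p"
proof -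
  obtain vs where vs: "length vs = p" "\<tau> = wedge_list vs"
    using assms(1) by (auto simp: simple_pvector_def)
  then show ?thesis
    using assms(2) wedge_list_nonzero_independent[of vs]
    by (simp add: pvector_space_wedge_list dim_eq_card_independent distinct_card)
qed

text \<open>
  Each product that spans the vertical vectors contains the factor $Z$ and is annihilated by it; this
  is a linear condition.
\<close>

lemma hZ_mem_pvector_space:
  assumes "vertical_pvector p \<tau>"
  shows "hZ \<in> pvector_space \<tau>"
proof -
  have "span {wedge_list (map hX js @ [hZ]) | js. Vt \<notin> set js \<and> length js + 1 = p}
      \<subseteq> {\<tau>. mvec hZ \<and>\<^sub>e \<tau> = 0}"
    by (intro span_minimal linear_subspace_kernel[OF linear_wedge_right])
      (auto simp: mvec_wedge_repeated_factor)
  then show ?thesis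
    using assms by (auto simp: vertical_pvector_def pvector_space_def)
qed

section \<open>Orthogonal maps between subspaces\<close>

text \<open>
  The reflection in the hyperplane orthogonal to \<open>a\<close>; for \<open>a = 0\<close> the division by zero makes it the
  identity.
\<close>

definition householder :: "'a::real_inner \<Rightarrow> 'a \<Rightarrow> 'a" where
  "householder a x = x - (2 * (a \<bullet> x) / (a \<bullet> a)) *\<^sub>R a"

lemma orthogonal_transformation_householder: "orthogonal_transformation (householder a)"
proof (cases "a = 0")
  case True
  then show ?thesis
    by (simp add: householder_def[abs_def])
next
  case False
  have "linear (householder a)"
    by (rule linearI)
      (simp_all add: householder_def inner_add_right add_divide_distrib algebra_simps)
  moreover have "householder a v \<bullet> householder a w = v \<bullet> w" for v w
    using False
    by (simp add: householder_def inner_diff_left inner_diff_right inner_commute field_simps)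
  ultimately show ?thesis
    by (simp add: orthogonal_transformation_def)
qed

lemma householder_swap:
  assumes "norm u = norm w"
  shows "householder (u - w) u = w"
proof (cases "u = w")
  case False
  have "u \<bullet> u = w \<bullet> w"
    using assms by (simp add: norm_eq)
  then have "(u - w) \<bullet> (u - w) = 2 * ((u - w) \<bullet> u)"
    by (simp add: inner_diff_left inner_diff_right inner_commute)
  moreover have "(u - w) \<bullet> (u - w) \<noteq> 0"
    using False by simp
  ultimately show ?thesis
    by (simp add: householder_def)
qed (simp add: householder_def)

lemma householder_fixes: "a \<bullet> x = 0 \<Longrightarrow> householder a x = x"
  by (simp add: householder_def)

text \<open>
  Basis vectors are corrected one at a time: once the others are mapped to their targets, both the
  current image of \<open>b\<close> and its target \<open>h b\<close> are orthogonal to those targets, so the reflection that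
  exchanges the two leaves the earlier corrections intact.
\<close>

lemma orthogonal_transformation_between_orthonormal_sets:
  fixes B :: "'a::euclidean_space set" and h :: "'a \<Rightarrow> 'a"
  assumes "finite B" "pairwise orthogonal B" "\<And>b. b \<in> B \<Longrightarrow> norm b = 1"
    and "inj_on h B" "pairwise orthogonal (h ` B)" "\<And>b. b \<in> B \<Longrightarrow> norm (h b) = 1"
  shows "\<exists>T. orthogonal_transformation T \<and> (\<forall>b\<in>B. T b = h b)"
  using assms
proof (induction B)
  case empty
  show ?case
    by (intro exI[of _ "\<lambda>x. x"]) simp
next
  case (insert b B)
  have "pairwise orthogonal B" "pairwise orthogonal (h ` B)"
    using insert.prems by (simp_all add: pairwise_insert)
  then obtain T where T: "orthogonal_transformation T" "\<And>c. c \<in> B \<Longrightarrow> T c = h c"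
    using insert by auto
  let ?R = "householder (T b - h b)"
  have "norm (T b) = norm (h b)"
    using T(1) insert.prems by (simp add: orthogonal_transformation_norm)
  then have "?R (T b) = h b"
    by (rule householder_swap)
  moreover have "?R (T c) = h c" if "c \<in> B" for c
  proof -
    have "b \<noteq> c" "h b \<noteq> h c"
      using insert.hyps insert.prems(3) that by auto
    then have "b \<bullet> c = 0" "h b \<bullet> h c = 0"
      using insert.prems(1,4) that by (auto simp: pairwise_def orthogonal_def)
    moreover have "T b \<bullet> T c = b \<bullet> c"
      using T(1) by (simp add: orthogonal_transformation_def)
    ultimately show ?thesis
      using that T(2) by (simp add: householder_fixes inner_diff_left)
  qed
  ultimately have "\<forall>c\<in>insert b B. (?R \<circ> T) c = h c"
    by simp
  then show ?case
    using orthogonal_transformation_compose[OF orthogonal_transformation_householder T(1)] by blast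
qed

lemma orthogonal_transformation_between_subspaces:
  fixes S S' :: "'a::euclidean_space set"
  assumes S: "subspace S" and S': "subspace S'" and dim: "dim S = dim S'"
    and z: "z \<in> S" "z \<in> S'"
  obtains T where "orthogonal_transformation T" "T ` S = S'" "T z = z"
proof -
  obtain B where B: "pairwise orthogonal B" "\<And>b. b \<in> B \<Longrightarrow> norm b = 1"
      "independent B" "card B = dim S" "span B = S"
    using orthonormal_basis_subspace[OF S] by blast
  obtain C where C: "pairwise orthogonal C" "\<And>b. b \<in> C \<Longrightarrow> norm b = 1"
      "independent C" "card C = dim S'" "span C = S'"
    using orthonormal_basis_subspace[OF S'] by blast
  have fin: "finite B" "finite C"
    using B C independent_imp_finite by auto
  then obtain h where h: "bij_betw h B C"
    using B C dim finite_same_card_bij by metis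
  then have "inj_on h B" "h ` B = C"
    by (auto simp: bij_betw_def)
  then obtain T where T: "orthogonal_transformation T" "\<And>b. b \<in> B \<Longrightarrow> T b = h b"
    using orthogonal_transformation_between_orthonormal_sets[of B h] B C fin by blast
  have "T ` S = span (T ` B)"
    using B(5) linear_span_image[OF orthogonal_transformation_linear[OF T(1)]] by blast
  also have "T ` B = C"
    using T(2) \<open>h ` B = C\<close> by force
  finally have TS: "T ` S = S'"
    using C by simp
  \<comment> \<open>Both \<open>T z\<close> and \<open>z\<close> lie in \<open>S'\<close>, hence the reflection exchanging them preserves \<open>S'\<close>.\<close>
  let ?R = "householder (T z - z)"
  have R: "orthogonal_transformation ?R"
    by (rule orthogonal_transformation_householder)
  have "T z - z \<in> S'"
    using z TS S' by (auto intro: subspace_diff)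
  then have "?R ` S' \<subseteq> S'"
    using S' by (auto simp: householder_def intro!: subspace_diff subspace_scale)
  moreover have "dim (?R ` S') = dim S'"
    using R by (intro dim_image_eq)
      (auto simp: orthogonal_transformation_linear intro: inj_on_subset orthogonal_transformation_inj)
  ultimately have "?R ` S' = S'"
    using S' R by (intro subspace_dim_equal)
      (auto intro: linear_subspace_image orthogonal_transformation_linear)
  then have "(?R \<circ> T) ` S = S'"
    by (simp only: image_comp[symmetric] TS)
  moreover have "(?R \<circ> T) z = z"
    using T(1) by (simp add: householder_swap orthogonal_transformation_norm)
  ultimately show thesis
    using that orthogonal_transformation_compose[OF R T(1)] by blast
qed

section \<open>Isometry invariance of Hausdorff measure\<close>

lemma diameter_isometry_image:
  assumes "\<And>x y. dist (f x) (f y) = dist x y"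
  shows "diameter (f ` A) = diameter A"
proof -
  have "(\<lambda>(x, y). dist x y) ` (f ` A \<times> f ` A) = (\<lambda>(x, y). dist x y) ` (A \<times> A)"
    using assms by (force simp: image_iff)
  then show ?thesis
    by (simp add: diameter_def)
qed

text \<open>
  A cover of \<open>A\<close> is pushed forward to a cover of the image by sets of the same diameters. The reverse
  inequality below applies this to the inverse isometry.
\<close>

lemma hausdorff_measure_isometry_image_le:
  fixes f :: "'a::metric_space \<Rightarrow> 'b::metric_space"
  assumes f: "\<And>x y. dist (f x) (f y) = dist x y"
  shows "hausdorff_measure p (f ` A) \<le> hausdorff_measure p A"
proof -
  have bdd: "bounded (f ` U)" if "bounded U" for U
    using that by (auto simp: bounded_def f) (metis f)
  have diam: "diameter (f ` U) = diameter U" for U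
    by (rule diameter_isometry_image) (rule f)
  have "hausdorff_pre p \<delta> (f ` A) \<le> hausdorff_pre p \<delta> A" for \<delta>
    unfolding hausdorff_pre_def
  proof (rule INF_mono)
    fix U :: "nat \<Rightarrow> 'a set"
    assume U: "U \<in> {U. A \<subseteq> (\<Union>i. U i) \<and> (\<forall>i. bounded (U i) \<and> diameter (U i) \<le> \<delta>)}"
    show "\<exists>V\<in>{V. f ` A \<subseteq> (\<Union>i. V i) \<and> (\<forall>i. bounded (V i) \<and> diameter (V i) \<le> \<delta>)}.
        (\<Sum>i. if V i = {} then 0 else ennreal (unit_ball_vol (real p) * (diameter (V i) / 2) ^ p))
        \<le> (\<Sum>i. if U i = {} then 0 else ennreal (unit_ball_vol (real p) * (diameter (U i) / 2) ^ p))"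
    proof (rule bexI[of _ "\<lambda>i. f ` U i"])
      show "(\<lambda>i. f ` U i) \<in> {V. f ` A \<subseteq> (\<Union>i. V i) \<and> (\<forall>i. bounded (V i) \<and> diameter (V i) \<le> \<delta>)}"
        using U by (simp add: bdd diam) blast
    qed (simp add: diam cong: if_cong)
  qed
  then show ?thesis
    unfolding hausdorff_measure_def by (intro SUP_mono) blast
qed

lemma hausdorff_measure_isometry_image:
  assumes f: "\<And>x y. dist (f x) (f y) = dist x y" and "surj f"
  shows "hausdorff_measure p (f ` A) = hausdorff_measure p A"
proof (rule antisym)
  show "hausdorff_measure p (f ` A) \<le> hausdorff_measure p A"
    by (rule hausdorff_measure_isometry_image_le[OF f])
  have "inj f"
    using f by (metis dist_eq_0_iff injI)
  then have "inv f ` f ` A = A"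
    by (simp add: image_comp)
  moreover have "dist (inv f x) (inv f y) = dist x y" for x y
    by (metis f \<open>surj f\<close> surj_f_inv_f)
  ultimately show "hausdorff_measure p A \<le> hausdorff_measure p (f ` A)"
    using hausdorff_measure_isometry_image_le[of "inv f" p "f ` A"] by simp
qed

section \<open>The metric factor\<close>

lemma metric_factor_eq:
  assumes "homogeneous_distance \<rho>"
  shows "metric_factor \<rho> p \<tau> = hausdorff_measure p {y \<in> pvector_space \<tau>. \<rho> 0 (std_coords y) < 1}"
proof -
  have "Metric_space UNIV \<rho>"
    using assms by (simp add: homogeneous_distance_def)
  then have "std_coords -` (hexp ` pvector_space \<tau> \<inter> Metric_space.mball UNIV \<rho> 0 1)
      = {y \<in> pvector_space \<tau>. \<rho> 0 (std_coords y) < 1}"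
    by (auto simp: Metric_space.in_mball std_coords_eq_hexp hexp_inject)
  then show ?thesis
    by (simp add: metric_factor_def)
qed

lemma horizontal_norm_eq: "horizontal_norm x = sqrt ((norm x)\<^sup>2 - (x $ Vt)\<^sup>2)"
proof -
  have "(norm x)\<^sup>2 = (\<Sum>j\<in>UNIV. (x $ j)\<^sup>2)"
    by (simp add: norm_vec_def L2_set_def sum_nonneg)
  also have "\<dots> = (x $ Vt)\<^sup>2 + (\<Sum>j\<in>-{Vt}. (x $ j)\<^sup>2)"
    by (simp add: sum.remove[of UNIV Vt] Compl_eq_Diff_UNIV)
  finally show ?thesis
    by (simp add: horizontal_norm_def L2_set_def)
qed

lemma orthogonal_transformation_fixing_hZ:
  assumes "orthogonal_transformation T" "T hZ = hZ"
  shows "T x $ Vt = x $ Vt" "horizontal_norm (T x) = horizontal_norm x"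
proof -
  have "T x \<bullet> hZ = x \<bullet> hZ"
    using assms by (metis orthogonal_transformation_def)
  then show *: "T x $ Vt = x $ Vt"
    by (simp add: hZ_def inner_axis)
  show "horizontal_norm (T x) = horizontal_norm x"
    by (simp add: horizontal_norm_eq * orthogonal_transformation_norm[OF assms(1)])
qed

theorem proposition4p5:
  fixes \<rho> :: "'n::{finite,linorder} heis \<Rightarrow> 'n heis \<Rightarrow> real"
    and p :: nat
    and \<tau> \<tau>' :: "real^('n hidx set)"
  assumes "homogeneous_distance \<rho>"
    and "\<exists>g :: real \<Rightarrow> real \<Rightarrow> real.
           \<forall>y. \<rho> 0 (std_coords y) = g (horizontal_norm y) (y $ Vt)"
    and "simple_pvector p \<tau>" "vertical_pvector p \<tau>" "\<tau> \<noteq> 0"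
    and "simple_pvector p \<tau>'" "vertical_pvector p \<tau>'" "\<tau>' \<noteq> 0"
  shows "metric_factor \<rho> p \<tau> = metric_factor \<rho> p \<tau>'"
proof -
  let ?A = "\<lambda>\<tau>. {y \<in> pvector_space \<tau>. \<rho> 0 (std_coords y) < 1}"
  have "dim (pvector_space \<tau>) = dim (pvector_space \<tau>')"
    using assms by (simp add: dim_pvector_space)
  moreover have "hZ \<in> pvector_space \<tau>" "hZ \<in> pvector_space \<tau>'"
    using assms hZ_mem_pvector_space by auto
  ultimately obtain T where T: "orthogonal_transformation T" "T ` pvector_space \<tau> = pvector_space \<tau>'"
      "T hZ = hZ"
    using orthogonal_transformation_between_subspaces[OF subspace_pvector_space subspace_pvector_space]
    by blast
  have "\<rho> 0 (std_coords (T y)) = \<rho> 0 (std_coords y)" for y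
    using assms(2) orthogonal_transformation_fixing_hZ[OF T(1,3), of y] by auto
  then have "?A \<tau>' = T ` ?A \<tau>"
    unfolding T(2)[symmetric] by auto
  moreover have "dist (T x) (T y) = dist x y" for x y
    using T(1) by (simp add: orthogonal_transformation_isometry)
  ultimately show ?thesis
    using hausdorff_measure_isometry_image[of T p "?A \<tau>"] orthogonal_transformation_surj[OF T(1)]
    by (simp add: metric_factor_eq[OF assms(1)])
qed

end
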